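(* Let $K$ be a field of characteristic $0$, $\theta=t\frac{d}{dt}$, $g'=\theta g$, and let $\mathcal{L}=\theta^n+\sum_{i=0}^{n-1}a_i\theta^i\in K(t)[\theta]$ be Calabi-Yau, with $\beta$-factor $\beta\in1+tK[[t]]$. Let $\Lambda_{\mathcal{L}}=K[[t]][\theta]/K[[t]][\theta]\mathcal{L}$ with generator $\eta$, $\eta^{(r)}=\theta^r\eta$, and $\operatorname{Fil}^i\subset\Lambda_{\mathcal{L}}$ the $K[[t]]$-span of $\eta^{(j)}$, $0\le j\le n-1-i$ (so $\operatorname{Fil}^{n}=0$). Then there exists a unique increasing filtration $(U_i)_{0\le i\le n-1}$ of $\Lambda_{\mathcal{L}}$ by $K[[t]][\theta]$-submodules such that for all $i$, $\Lambda_{\mathcal{L}}=U_i\oplus\operatorname{Fil}^{i+1}$ and $U_{i+1}/U_i$ are trivial $K[[t]][\theta]$-modules. Moreover, up to multiplication by constants, there is a unique sequence $u_0,\dots,u_{n-1}$ such that (i) $U_i$ is generated as a $K[[t]]$-module by $u_0,\dots,u_i$; (ii) $u_i=\sum_{r=0}^{n-1-i}v_{i,r}\eta^{(r)}$ with $v_{i,n-1-i}=\beta\,wr_i/wr_{i-1}$. Consequently $u_{i+1}'=\tau_{i+1}u_i$ with $\tau_{i+1}=wr_{i-1}wr_{i+1}/wr_i^2$, and in particular $\tau_1=(\log q)'$.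
   Context: $\mathcal{L}$ satisfies condition (N) if $a_i\in K(t)\cap K[[t]]$ and $a_i(0)=0$ for all $i$ (indicial polynomial $s^n$ at $0$). A $\beta$-factor is a non-zero solution of $n\beta'=2a_{n-1}\beta$ (it can be taken in $1+tK[[t]]$ under (N)). The formal adjoint is $\mathcal{L}^*=(-1)^n\theta^n+\sum_i(-1)^i\theta^ia_i$; $\mathcal{L}$ is self-adjoint if $\mathcal{L}^*=(-1)^n\beta\mathcal{L}\beta^{-1}$. $\mathcal{L}$ is Calabi-Yau if it is self-adjoint and satisfies (N). $F=F_0\in1+tK[[t]]$ is the unique power-series solution of $\mathcal{L}F=0$ with constant term $1$; for $1\le i\le n-1$, $F_i$ are solutions of $\mathcal{L}$ with $\sum_{r=0}^i(-1)^rF_{i-r}\frac{\log^r t}{r!}\in K[[t]]$ (the Frobenius basis at $0$). $wr_i=\det(F_r^{(s)})_{0\le r,s\le i}$ is the Wronskian of $F_0,\dots,F_i$ with respect to $\theta$, with $wr_{-1}:=1$. The $q$-coordinate is $q=\exp(F_1/F)$. *)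

theory Defs
  imports "HOL-Computational_Algebra.Polynomial_FPS" "Jordan_Normal_Form.Determinant"
begin

definition theta :: "'a::field_char_0 fps \<Rightarrow> 'a fps" where
  "theta f = fps_X * fps_deriv f"

definition rational_fps :: "'a::field_char_0 fps \<Rightarrow> bool" where
  "rational_fps f \<longleftrightarrow> (\<exists>p q. poly q 0 \<noteq> 0 \<and> fps_of_poly q * f = fps_of_poly p)"

text \<open>Differential operators in K[[t]][theta], represented as sum of (coeff p i) theta^i,
  coefficients on the left; the product uses theta^i d = sum_k (i choose k) theta^k(d) theta^(i-k).\<close>
definition dop_mult :: "'a::field_char_0 fps poly \<Rightarrow> 'a fps poly \<Rightarrow> 'a fps poly" where
  "dop_mult p q = (\<Sum>i\<le>degree p. \<Sum>j\<le>degree q. \<Sum>k\<le>i.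
      monom (coeff p i * of_nat (i choose k) * (theta ^^ k) (coeff q j)) (i - k + j))"

definition L_op :: "nat \<Rightarrow> (nat \<Rightarrow> 'a::field_char_0 fps) \<Rightarrow> 'a fps poly" where
  "L_op n a = monom 1 n + (\<Sum>i<n. monom (a i) i)"

definition adjoint :: "'a::field_char_0 fps poly \<Rightarrow> 'a fps poly" where
  "adjoint p = (\<Sum>i\<le>degree p. Polynomial.smult ((-1) ^ i) (dop_mult (monom 1 i) [:coeff p i:]))"

definition condN :: "nat \<Rightarrow> (nat \<Rightarrow> 'a::field_char_0 fps) \<Rightarrow> bool" where
  "condN n a \<longleftrightarrow> (\<forall>i<n. rational_fps (a i) \<and> fps_nth (a i) 0 = 0)"

definition beta_factor :: "nat \<Rightarrow> (nat \<Rightarrow> 'a::field_char_0 fps) \<Rightarrow> 'a fps \<Rightarrow> bool" where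
  "beta_factor n a \<beta> \<longleftrightarrow> \<beta> \<noteq> 0 \<and> of_nat n * theta \<beta> = 2 * a (n - 1) * \<beta>"

definition self_adjoint :: "nat \<Rightarrow> (nat \<Rightarrow> 'a::field_char_0 fps) \<Rightarrow> 'a fps \<Rightarrow> bool" where
  "self_adjoint n a \<beta> \<longleftrightarrow>
     adjoint (L_op n a) = Polynomial.smult ((-1) ^ n) (dop_mult [:\<beta>:] (dop_mult (L_op n a) [:inverse \<beta>:]))"

definition calabi_yau :: "nat \<Rightarrow> (nat \<Rightarrow> 'a::field_char_0 fps) \<Rightarrow> 'a fps \<Rightarrow> bool" where
  "calabi_yau n a \<beta> \<longleftrightarrow> self_adjoint n a \<beta> \<and> condN n a"

text \<open>Log-series: K[[t]][l] with l = log t, represented as 'a fps poly in l; theta l = 1.\<close>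
definition theta_log :: "'a::field_char_0 fps poly \<Rightarrow> 'a fps poly" where
  "theta_log p = map_poly theta p + pderiv p"

definition apply_op :: "'a::field_char_0 fps poly \<Rightarrow> 'a fps poly \<Rightarrow> 'a fps poly" where
  "apply_op L f = (\<Sum>i\<le>degree L. [:coeff L i:] * (theta_log ^^ i) f)"

definition frobenius_basis :: "nat \<Rightarrow> (nat \<Rightarrow> 'a::field_char_0 fps) \<Rightarrow> (nat \<Rightarrow> 'a fps poly) \<Rightarrow> bool" where
  "frobenius_basis n a F \<longleftrightarrow>
     (\<exists>F0. F 0 = [:F0:] \<and> fps_nth F0 0 = 1) \<and>
     (\<forall>i<n. apply_op (L_op n a) (F i) = 0) \<and>
     (\<forall>i. 1 \<le> i \<and> i < n \<longrightarrow>
        degree (\<Sum>r\<le>i. Polynomial.smult (fps_const ((-1) ^ r / fact r)) (F (i - r) * monom 1 r)) = 0)"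

text \<open>wronsk F k = Wronskian (w.r.t. theta) of F_0..F_(k-1); so wr_i = wronsk F (i+1), wr_(-1) = wronsk F 0 = 1\<close>
definition wronsk :: "(nat \<Rightarrow> 'a::field_char_0 fps poly) \<Rightarrow> nat \<Rightarrow> 'a fps poly" where
  "wronsk F k = det (mat k k (\<lambda>(r, s). (theta_log ^^ s) (F r)))"

text \<open>Lambda_L, elements written in the K[[t]]-basis eta^(0..n-1): coordinate vectors\<close>
definition lam :: "nat \<Rightarrow> (nat \<Rightarrow> 'a::field_char_0 fps) set" where
  "lam n = {v. \<forall>r\<ge>n. v r = 0}"

text \<open>action of theta on Lambda_L, using eta^(n) = - sum a_i eta^(i)\<close>
definition theta_lam :: "nat \<Rightarrow> (nat \<Rightarrow> 'a::field_char_0 fps) \<Rightarrow> (nat \<Rightarrow> 'a fps) \<Rightarrow> (nat \<Rightarrow> 'a fps)" where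
  "theta_lam n a v = (\<lambda>r. if r < n then theta (v r) + (if r = 0 then 0 else v (r - 1)) - a r * v (n - 1) else 0)"

definition submod :: "nat \<Rightarrow> (nat \<Rightarrow> 'a::field_char_0 fps) \<Rightarrow> (nat \<Rightarrow> 'a fps) set \<Rightarrow> bool" where
  "submod n a U \<longleftrightarrow> U \<subseteq> lam n \<and> (\<lambda>r. 0) \<in> U \<and>
     (\<forall>x\<in>U. \<forall>y\<in>U. (\<lambda>r. x r + y r) \<in> U) \<and>
     (\<forall>c. \<forall>x\<in>U. (\<lambda>r. c * x r) \<in> U) \<and>
     (\<forall>x\<in>U. theta_lam n a x \<in> U)"

definition Fil :: "nat \<Rightarrow> nat \<Rightarrow> (nat \<Rightarrow> 'a::field_char_0 fps) set" where
  "Fil n i = {v \<in> lam n. \<forall>r. n - i \<le> r \<longrightarrow> v r = 0}"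

definition direct_sum :: "nat \<Rightarrow> (nat \<Rightarrow> 'a::field_char_0 fps) set \<Rightarrow> (nat \<Rightarrow> 'a fps) set \<Rightarrow> bool" where
  "direct_sum n U W \<longleftrightarrow> (\<forall>v\<in>lam n. \<exists>u\<in>U. \<exists>w\<in>W. v = (\<lambda>r. u r + w r)) \<and> U \<inter> W = {\<lambda>r. 0}"

text \<open>M/N is a trivial K[[t]][theta]-module: it has a finite K[[t]]-basis of theta-flat classes\<close>
definition trivial_quotient :: "nat \<Rightarrow> (nat \<Rightarrow> 'a::field_char_0 fps) \<Rightarrow> (nat \<Rightarrow> 'a fps) set \<Rightarrow> (nat \<Rightarrow> 'a fps) set \<Rightarrow> bool" where
  "trivial_quotient n a M N \<longleftrightarrow> (\<exists>ws. set ws \<subseteq> M \<and>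
     (\<forall>w\<in>set ws. theta_lam n a w \<in> N) \<and>
     (\<forall>m\<in>M. \<exists>c. (\<lambda>r. m r - (\<Sum>j<length ws. c j * (ws ! j) r)) \<in> N) \<and>
     (\<forall>c. (\<lambda>r. \<Sum>j<length ws. c j * (ws ! j) r) \<in> N \<longrightarrow> (\<forall>j<length ws. c j = 0)))"

definition admissible_filtration :: "nat \<Rightarrow> (nat \<Rightarrow> 'a::field_char_0 fps) \<Rightarrow> (nat \<Rightarrow> (nat \<Rightarrow> 'a fps) set) \<Rightarrow> bool" where
  "admissible_filtration n a U \<longleftrightarrow>
     (\<forall>i<n. submod n a (U i)) \<and>
     (\<forall>i. Suc i < n \<longrightarrow> U i \<subseteq> U (Suc i)) \<and>
     (\<forall>i<n. direct_sum n (U i) (Fil n (Suc i))) \<and>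
     (\<forall>i<n. trivial_quotient n a (U i) (if i = 0 then {\<lambda>r. 0} else U (i - 1)))"

definition good_sequence :: "nat \<Rightarrow> (nat \<Rightarrow> 'a::field_char_0 fps poly) \<Rightarrow> 'a fps \<Rightarrow> (nat \<Rightarrow> (nat \<Rightarrow> 'a fps) set)
     \<Rightarrow> (nat \<Rightarrow> nat \<Rightarrow> 'a fps) \<Rightarrow> bool" where
  "good_sequence n F \<beta> U u \<longleftrightarrow> (\<forall>i<n.
     u i \<in> lam n \<and>
     U i = {(\<lambda>r. \<Sum>j\<le>i. c j * u j r) | c. True} \<and>
     (\<forall>r. n - 1 - i < r \<longrightarrow> u i r = 0) \<and>
     [:u i (n - 1 - i):] * wronsk F i = [:\<beta>:] * wronsk F (Suc i))"

end

theory Submission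
  imports Defs
begin

text \<open>
  The operator has a unique factorization \<open>L = A\<^sub>n \<theta> A\<^sub>n\<^sub>-\<^sub>1 \<theta> \<dots> \<theta> A\<^sub>0\<close> into units with constant
  term \<open>1\<close> whose partial products \<open>Y\<^sub>k = A\<^sub>k \<theta> \<dots> \<theta> A\<^sub>0\<close> satisfy \<open>Y\<^sub>k F\<^sub>r = 0\<close> for \<open>r < k\<close> and
  \<open>Y\<^sub>k F\<^sub>k = 1\<close>. The \<open>Y\<^sub>k\<close> therefore triangularize the Wronskian matrix, and
  \<open>wr\<^sub>k / wr\<^sub>k\<^sub>-\<^sub>1 = 1 / (A\<^sub>0 \<dots> A\<^sub>k)\<close>. Taking adjoints reverses the factorization, so self-adjointness
  and uniqueness give \<open>A\<^sub>0 = \<beta> A\<^sub>n\<close> and \<open>A\<^sub>k = A\<^sub>n\<^sub>-\<^sub>k\<close> for \<open>0 < k < n\<close>. Since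
  \<open>\<theta> Y\<^sub>k = A\<^sub>k\<^sub>+\<^sub>1\<^sup>-\<^sup>1 Y\<^sub>k\<^sub>+\<^sub>1\<close>, the elements \<open>u\<^sub>i = Y\<^sub>n\<^sub>-\<^sub>1\<^sub>-\<^sub>i\<close> form a flag of submodules with trivial
  quotients, and the symmetry of the \<open>A\<^sub>k\<close> says that their leading coefficients are
  \<open>\<beta> wr\<^sub>i / wr\<^sub>i\<^sub>-\<^sub>1\<close> and that \<open>\<tau>\<^sub>i = 1 / A\<^sub>i\<close>. Uniqueness of the flag holds because an element that is
  flat modulo \<open>U\<^sub>i\<close> already lies in \<open>U\<^sub>i\<^sub>+\<^sub>1\<close>.
\<close>

section \<open>The derivation theta on power series and on log series\<close>

lemma theta_simps [simp]:
  "theta 0 = 0" "theta 1 = 0" "theta (fps_const c) = 0"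
  "theta (f + g) = theta f + theta g" "theta (f - g) = theta f - theta g" "theta (- f) = - theta f"
  "fps_nth (theta f) 0 = 0"
  by (auto simp: theta_def algebra_simps)

lemma theta_mult: "theta (f * g) = theta f * g + f * theta g"
  by (simp add: theta_def algebra_simps)

lemma theta_sum: "theta (\<Sum>i\<in>A. f i) = (\<Sum>i\<in>A. theta (f i))"
  by (induction A rule: infinite_finite_induct) auto

lemma theta_eq_0_iff: "theta f = 0 \<longleftrightarrow> (\<exists>c. f = fps_const c)"
  by (auto simp: theta_def fps_deriv_eq_0_iff)

lemma coeff_theta_log:
  "coeff (theta_log p) i = theta (coeff p i) + of_nat (Suc i) * coeff p (Suc i)"
  by (simp add: theta_log_def coeff_map_poly coeff_pderiv)

lemma theta_log_simps [simp]:
  "theta_log 0 = 0" "theta_log 1 = 0" "theta_log [:c:] = [:theta c:]"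
  "theta_log (f + g) = theta_log f + theta_log g" "theta_log (f - g) = theta_log f - theta_log g"
  "theta_log (- f) = - theta_log f"
  by (auto simp: poly_eq_iff coeff_theta_log algebra_simps coeff_pCons one_pCons split: nat.splits)

lemma theta_log_sum: "theta_log (\<Sum>i\<in>A. f i) = (\<Sum>i\<in>A. theta_log (f i))"
  by (induction A rule: infinite_finite_induct) auto

lemma theta_log_mult: "theta_log (f * g) = theta_log f * g + f * theta_log g"
proof -
  have "map_poly theta (f * g) = map_poly theta f * g + f * map_poly theta g"
    by (simp add: poly_eq_iff coeff_map_poly coeff_mult theta_sum theta_mult sum.distrib)
  then show ?thesis
    by (simp add: theta_log_def pderiv_mult algebra_simps)
qed

lemma theta_log_smult:
  "theta_log (Polynomial.smult c f) = Polynomial.smult (theta c) f + Polynomial.smult c (theta_log f)"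
  using theta_log_mult[of "[:c:]" f] by simp

lemma theta_log_of_nat_mult: "theta_log (of_nat k * f) = of_nat k * theta_log f"
  by (induction k) (auto simp: algebra_simps)

lemma theta_log_funpow_zero [simp]: "(theta_log ^^ i) 0 = 0"
  by (induction i) auto

lemma theta_log_funpow_add: "(theta_log ^^ i) (f + g) = (theta_log ^^ i) f + (theta_log ^^ i) g"
  by (induction i) auto

lemma theta_log_funpow_sum: "(theta_log ^^ i) (\<Sum>x\<in>A. f x) = (\<Sum>x\<in>A. (theta_log ^^ i) (f x))"
  by (induction A rule: infinite_finite_induct) (auto simp: theta_log_funpow_add)

text \<open>Leibniz rule with the binomial weights that occur in \<open>dop_mult\<close>. The
  induction step is Pascal's rule, applied once the second sum is extended by a zero term and
  shifted by one.\<close>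

lemma theta_log_funpow_const_mult:
  "(theta_log ^^ i) ([:c:] * g) =
    (\<Sum>k\<le>i. [:of_nat (i choose k) * (theta ^^ k) c:] * (theta_log ^^ (i - k)) g)"
proof (induction i)
  case 0
  show ?case by simp
next
  case (Suc i)
  define T where "T k j = [:(theta ^^ k) c:] * (theta_log ^^ j) g" for k j
  have T: "theta_log (of_nat m * T k j) = of_nat m * T (Suc k) j + of_nat m * T k (Suc j)" for m k j
    by (simp add: T_def theta_log_of_nat_mult theta_log_smult algebra_simps)
  have conv: "[:of_nat m * (theta ^^ k) c:] * (theta_log ^^ j) g = of_nat m * T k j" for m k j
    by (simp add: T_def of_nat_poly mult.commute)
  have "(theta_log ^^ Suc i) ([:c:] * g) = theta_log (\<Sum>k\<le>i. of_nat (i choose k) * T k (i - k))"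
    by (simp only: funpow.simps o_apply Suc.IH conv)
  also have "\<dots> = (\<Sum>k\<le>i. of_nat (i choose k) * T (Suc k) (i - k)) +
                   (\<Sum>k\<le>i. of_nat (i choose k) * T k (Suc i - k))"
    by (simp add: theta_log_sum T sum.distrib Suc_diff_le)
  also have "(\<Sum>k\<le>i. of_nat (i choose k) * T k (Suc i - k)) =
             (\<Sum>k\<le>Suc i. of_nat (i choose k) * T k (Suc i - k))"
    by (simp add: binomial_eq_0)
  also have "\<dots> = T 0 (Suc i) + (\<Sum>k\<le>i. of_nat (i choose Suc k) * T (Suc k) (i - k))"
    by (subst sum.atMost_Suc_shift) simp
  also have "(\<Sum>k\<le>i. of_nat (i choose k) * T (Suc k) (i - k)) + \<dots> =
             T 0 (Suc i) + (\<Sum>k\<le>i. of_nat (Suc i choose Suc k) * T (Suc k) (i - k))"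
    by (simp add: algebra_simps sum.distrib)
  also have "\<dots> = (\<Sum>k\<le>Suc i. of_nat (Suc i choose k) * T k (Suc i - k))"
    by (subst sum.atMost_Suc_shift) simp
  finally show ?case by (simp only: conv)
qed

section \<open>Differential operators acting on log series\<close>

lemma apply_op_eq_sum:
  assumes "degree p \<le> m"
  shows "apply_op p f = (\<Sum>i\<le>m. [:coeff p i:] * (theta_log ^^ i) f)"
  unfolding apply_op_def using assms
  by (intro sum.mono_neutral_left) (auto simp: coeff_eq_0)

lemma apply_op_add: "apply_op (p + q) f = apply_op p f + apply_op q f"
proof -
  define m where "m = max (degree p) (degree q)"
  have "degree (p + q) \<le> m" "degree p \<le> m" "degree q \<le> m"
    by (auto simp: m_def degree_add_le)
  then show ?thesis
    by (simp add: apply_op_eq_sum[where m = m] sum.distrib[symmetric] smult_add_left)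
qed

lemma apply_op_smult: "apply_op (Polynomial.smult c p) f = [:c:] * apply_op p f"
proof -
  have "degree (Polynomial.smult c p) \<le> degree p" by simp
  then show ?thesis
    by (simp add: apply_op_eq_sum[where m = "degree p"] sum_distrib_left mult.commute)
qed

lemma apply_op_zero [simp]: "apply_op 0 f = 0"
  by (simp add: apply_op_def)

lemma apply_op_diff: "apply_op (p - q) f = apply_op p f - apply_op q f"
  using apply_op_add[of "p - q" q f] by (simp add: algebra_simps)

lemma apply_op_sum: "apply_op (\<Sum>x\<in>A. p x) f = (\<Sum>x\<in>A. apply_op (p x) f)"
  by (induction A rule: infinite_finite_induct) (auto simp: apply_op_add)

lemma apply_op_monom: "apply_op (monom c m) f = [:c:] * (theta_log ^^ m) f"
proof -
  have "apply_op (monom c m) f = (\<Sum>i\<le>m. [:coeff (monom c m) i:] * (theta_log ^^ i) f)"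
    by (rule apply_op_eq_sum) (rule degree_monom_le)
  also have "\<dots> = (\<Sum>i\<in>{m}. [:coeff (monom c m) i:] * (theta_log ^^ i) f)"
    by (rule sum.mono_neutral_right) auto
  finally show ?thesis by simp
qed

lemma apply_op_const [simp]: "apply_op [:c:] f = [:c:] * f"
  using apply_op_monom[of c 0 f] by (simp add: monom_0)

text \<open>The Leibniz rule identifies the coefficientwise product with composition, so an identity
  between operators can be exploited by evaluating both sides.\<close>

lemma apply_op_dop_mult: "apply_op (dop_mult p q) f = apply_op p (apply_op q f)"
proof -
  have *: "[:c * of_nat m * d:] * g = [:c:] * ([:of_nat m * d:] * g)" for c d :: "'a fps" and m g
    by (simp add: mult_ac)
  have "apply_op (dop_mult p q) f = (\<Sum>i\<le>degree p. [:coeff p i:] * (\<Sum>j\<le>degree q. \<Sum>k\<le>i.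
          [:of_nat (i choose k) * (theta ^^ k) (coeff q j):] * (theta_log ^^ (i - k)) ((theta_log ^^ j) f)))"
    unfolding dop_mult_def apply_op_sum apply_op_monom sum_distrib_left funpow_add o_apply *  ..
  also have "\<dots> = apply_op p (apply_op q f)"
    unfolding apply_op_def theta_log_funpow_sum theta_log_funpow_const_mult ..
  finally show ?thesis .
qed

text \<open>The operator product \<open>\<theta> p\<close>, from \<open>\<theta> c = \<theta>(c) + c \<theta>\<close> for a coefficient \<open>c\<close>.\<close>
definition theta_comp :: "'a::field_char_0 fps poly \<Rightarrow> 'a fps poly" where
  "theta_comp p = map_poly theta p + pCons 0 p"

lemma coeff_theta_comp:
  "coeff (theta_comp p) r = theta (coeff p r) + (if r = 0 then 0 else coeff p (r - 1))"
  by (cases r) (simp_all add: theta_comp_def coeff_map_poly)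

lemma degree_theta_comp_le: "degree (theta_comp p) \<le> Suc (degree p)"
  by (rule degree_le) (auto simp: coeff_theta_comp coeff_eq_0)

text \<open>The resummation shared by the action of an operator and that of its adjoint:
  \<open>h\<close> is any expression that is additive in the coefficient.\<close>

lemma sum_theta_comp:
  fixes h :: "'a::field_char_0 fps \<Rightarrow> nat \<Rightarrow> 'b::comm_monoid_add"
  assumes "\<And>x y i. h (x + y) i = h x i + h y i" "\<And>i. h 0 i = 0" "degree p \<le> m"
  shows "(\<Sum>i\<le>Suc m. h (coeff (theta_comp p) i) i) =
         (\<Sum>i\<le>m. h (theta (coeff p i)) i) + (\<Sum>i\<le>m. h (coeff p i) (Suc i))"
proof -
  have "coeff p (Suc m) = 0" using assms(3) by (simp add: coeff_eq_0)
  have "(\<Sum>i\<le>Suc m. h (coeff (theta_comp p) i) i) = (\<Sum>i\<le>Suc m. h (theta (coeff p i)) i) +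
          (\<Sum>i\<le>Suc m. h (if i = 0 then 0 else coeff p (i - 1)) i)"
    by (simp only: coeff_theta_comp assms(1) sum.distrib)
  also have "(\<Sum>i\<le>Suc m. h (if i = 0 then 0 else coeff p (i - 1)) i) = (\<Sum>i\<le>m. h (coeff p i) (Suc i))"
    by (subst sum.atMost_Suc_shift) (simp add: assms(2))
  finally show ?thesis using \<open>coeff p (Suc m) = 0\<close> by (simp add: assms(2))
qed

lemma apply_op_theta_comp: "apply_op (theta_comp p) f = theta_log (apply_op p f)"
proof -
  have "apply_op (theta_comp p) f =
          (\<Sum>i\<le>Suc (degree p). [:coeff (theta_comp p) i:] * (theta_log ^^ i) f)"
    by (rule apply_op_eq_sum) (rule degree_theta_comp_le)
  also have "\<dots> = (\<Sum>i\<le>degree p. [:theta (coeff p i):] * (theta_log ^^ i) f) +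
                  (\<Sum>i\<le>degree p. [:coeff p i:] * (theta_log ^^ Suc i) f)"
    by (rule sum_theta_comp) (auto simp: smult_add_left)
  also have "\<dots> = theta_log (apply_op p f)"
    by (simp add: apply_op_def theta_log_sum theta_log_mult sum.distrib del: mult_pCons_left)
  finally show ?thesis .
qed

lemma coeff_L_op: "coeff (L_op n a) r = (if r < n then a r else if r = n then 1 else 0)"
  by (auto simp: L_op_def coeff_sum)

text \<open>Residues modulo \<open>L_op n a\<close> are represented by operators of degree below
  \<open>n\<close>. Left multiplication by theta can create a term of degree \<open>n\<close>, which
  the subtracted multiple of the monic \<open>L_op n a\<close> removes.\<close>

lemma theta_lam_coeff:
  assumes "degree p < n"
  shows "theta_lam n a (coeff p) = coeff (theta_comp p - Polynomial.smult (coeff p (n - 1)) (L_op n a))"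
  using assms
  by (auto simp: fun_eq_iff theta_lam_def coeff_theta_comp coeff_L_op coeff_eq_0)

section \<open>The formal adjoint, evaluated on log series\<close>

definition adjoint_app :: "'a::field_char_0 fps poly \<Rightarrow> 'a fps poly \<Rightarrow> 'a fps poly" where
  "adjoint_app p f = (\<Sum>i\<le>degree p. (-1) ^ i * (theta_log ^^ i) ([:coeff p i:] * f))"

lemma adjoint_app_eq_sum:
  assumes "degree p \<le> m"
  shows "adjoint_app p f = (\<Sum>i\<le>m. (-1) ^ i * (theta_log ^^ i) ([:coeff p i:] * f))"
  unfolding adjoint_app_def using assms
  by (intro sum.mono_neutral_left) (auto simp: coeff_eq_0)

lemma const_minus_one_power: "[:(-1) ^ i:] = ((-1) ^ i :: 'a::comm_ring_1 poly)"
  proof (induction i)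
  case (Suc i)
  have "[:(-1) ^ Suc i:] = - [:(-1) ^ i :: 'a:]" by simp
  then show ?case by (simp only: Suc.IH power_Suc mult_minus1)
qed (simp add: one_pCons)

lemma apply_op_adjoint: "apply_op (adjoint p) f = adjoint_app p f"
  unfolding adjoint_def apply_op_sum apply_op_smult apply_op_dop_mult apply_op_monom
    apply_op_const adjoint_app_def const_minus_one_power by (simp add: one_pCons)

lemma adjoint_app_smult: "adjoint_app (Polynomial.smult c p) f = adjoint_app p ([:c:] * f)"
proof -
  have "degree (Polynomial.smult c p) \<le> degree p" by simp
  then show ?thesis
    by (simp add: adjoint_app_eq_sum[where m = "degree p"] mult.commute)
qed

text \<open>Adjunction reverses products and sends theta to its negative; the factor on the left of
  \<open>p\<close> therefore acts first.\<close>

lemma adjoint_app_theta_comp: "adjoint_app (theta_comp p) f = - adjoint_app p (theta_log f)"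
proof -
  have "adjoint_app (theta_comp p) f =
          (\<Sum>i\<le>Suc (degree p). (-1) ^ i * (theta_log ^^ i) ([:coeff (theta_comp p) i:] * f))"
    by (rule adjoint_app_eq_sum) (rule degree_theta_comp_le)
  also have "\<dots> = (\<Sum>i\<le>degree p. (-1) ^ i * (theta_log ^^ i) ([:theta (coeff p i):] * f)) +
                  (\<Sum>i\<le>degree p. (-1) ^ Suc i * (theta_log ^^ Suc i) ([:coeff p i:] * f))"
    by (rule sum_theta_comp) (auto simp: smult_add_left theta_log_funpow_add algebra_simps)
  also have "\<dots> = - adjoint_app p (theta_log f)"
    by (simp add: adjoint_app_def theta_log_smult theta_log_funpow_add funpow_swap1 algebra_simps
        sum.distrib sum_negf sum_subtractf)
  finally show ?thesis .
qed

section \<open>Factored operators and the removal of logarithms\<close>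

text \<open>These are the operators \<open>Y\<^sub>k\<close>, expanded into powers of theta.\<close>

primrec theta_chain :: "(nat \<Rightarrow> 'a::field_char_0 fps) \<Rightarrow> nat \<Rightarrow> 'a fps poly" where
  "theta_chain A 0 = [:A 0:]"
| "theta_chain A (Suc k) = Polynomial.smult (A (Suc k)) (theta_comp (theta_chain A k))"

text \<open>The same composition carried out on a log series, so that factors can be changed or
  shifted without expanding operators.\<close>

primrec chain_app :: "(nat \<Rightarrow> 'a::field_char_0 fps) \<Rightarrow> nat \<Rightarrow> 'a fps poly \<Rightarrow> 'a fps poly" where
  "chain_app A 0 f = [:A 0:] * f"
| "chain_app A (Suc k) f = [:A (Suc k):] * theta_log (chain_app A k f)"

lemma apply_op_theta_chain: "apply_op (theta_chain A k) f = chain_app A k f"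
  by (induction k) (simp_all add: apply_op_smult apply_op_theta_comp)

lemma degree_theta_chain: "degree (theta_chain A k) \<le> k"
proof (induction k)
  case (Suc k)
  then show ?case
    using degree_theta_comp_le[of "theta_chain A k"] degree_smult_le[of "A (Suc k)" "theta_comp (theta_chain A k)"]
    unfolding theta_chain.simps by linarith
qed simp

lemma coeff_theta_chain_eq_0: "k < r \<Longrightarrow> coeff (theta_chain A k) r = 0"
  using degree_theta_chain[of A k] by (simp add: coeff_eq_0)

lemma lead_coeff_theta_chain: "coeff (theta_chain A k) k = (\<Prod>j\<le>k. A j)"
  by (induction k) (simp_all add: coeff_theta_comp coeff_theta_chain_eq_0 mult.commute)

lemma chain_app_cong: "(\<And>j. j \<le> k \<Longrightarrow> A j = B j) \<Longrightarrow> chain_app A k f = chain_app B k f"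
  by (induction k) auto

lemma chain_app_zero_mono:
  assumes "theta_log (chain_app A k f) = 0" "k < m"
  shows "chain_app A m f = 0"
  using assms(2,1) by (induction m) (auto simp: less_Suc_eq)

lemma chain_app_Suc_shift:
  "chain_app A (Suc k) f = chain_app (\<lambda>j. A (Suc j)) k (theta_log ([:A 0:] * f))"
  by (induction k) simp_all

lemma chain_app_const_mult:
  "chain_app A k ([:c:] * f) = chain_app (A(0 := A 0 * c)) k f"
  by (induction k) (simp_all add: mult.commute)

text \<open>Induction on the length: the outermost factor of the chain becomes the innermost one of
  the adjoint, which is why \<open>f\<close> must vary.\<close>

lemma adjoint_app_theta_chain:
  "adjoint_app (theta_chain A k) f = (-1) ^ k * chain_app (\<lambda>j. A (k - j)) k f"
proof (induction k arbitrary: f)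
  case 0
  show ?case by (simp add: adjoint_app_eq_sum[where m = 0])
next
  case (Suc k)
  have "adjoint_app (theta_chain A (Suc k)) f = - adjoint_app (theta_chain A k) (theta_log ([:A (Suc k):] * f))"
    by (simp only: theta_chain.simps adjoint_app_smult adjoint_app_theta_comp)
  then show ?case
    unfolding Suc.IH chain_app_Suc_shift by simp
qed

text \<open>A non-zero constant is not a unit multiple of a \<open>\<theta>\<close>-derivative of a power series, so in
  a chain with unit coefficients constants pull back to constants only.\<close>
lemma chain_app_kernel:
  assumes "chain_app A m f = [:fps_const c:]" "chain_app A k f = [:g:]" "k \<le> m"
    and "\<And>j. j \<le> m \<Longrightarrow> fps_nth (A j) 0 = 1"
  shows "\<exists>d. g = fps_const d"
  using assms(3,1,4)
proof (induction m arbitrary: c rule: dec_induct)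
  case base
  then show ?case using assms(2) by simp
next
  case (step m)
  \<comment> \<open>A chain that is free of logarithms at stage \<open>k\<close> remains so at all
    later stages.\<close>
  have "\<exists>h. chain_app A (k + d) f = [:h:]" for d
    by (induction d) (auto simp: assms(2))
  from this[of "m - k"] obtain h where h: "chain_app A m f = [:h:]"
    using step.hyps by auto
  have "A (Suc m) * theta h = fps_const c"
    using step.prems(1) by (simp add: h mult.commute)
  moreover from this have "c = 0"
    by (metis fps_mult_nth_0 fps_nth_fps_const mult_zero_right theta_simps(7))
  moreover have "A (Suc m) \<noteq> 0"
    using step.prems(2)[of "Suc m"] by auto
  ultimately have "theta h = 0" by simp
  then obtain d where "h = fps_const d" by (auto simp: theta_eq_0_iff)
  with step.IH[of d] h step.prems(2) show ?case by simp
qed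

text \<open>On generating series \<open>\<Sum> V\<^sub>i x\<^sup>i\<close> this is multiplication by \<open>exp (- x log t)\<close>.\<close>
definition log_strip :: "(nat \<Rightarrow> 'a::field_char_0 fps poly) \<Rightarrow> nat \<Rightarrow> 'a fps poly" where
  "log_strip V i = (\<Sum>r\<le>i. Polynomial.smult (fps_const ((-1) ^ r / fact r)) (V (i - r) * monom 1 r))"

lemma log_strip_0 [simp]: "log_strip V 0 = V 0"
  by (simp add: log_strip_def)

lemma log_strip_const_mult: "log_strip (\<lambda>m. [:c:] * V m) i = [:c:] * log_strip V i"
  by (simp add: log_strip_def sum_distrib_left mult.commute)

text \<open>Theta applied to \<open>exp (- x log t)\<close> multiplies it by \<open>- x\<close>; on
  coefficients this is the index shift in the second term.\<close>

lemma theta_log_log_strip: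
  "theta_log (log_strip V (Suc i)) = log_strip (\<lambda>m. theta_log (V m)) (Suc i) - log_strip V i"
proof -
  define T :: "nat \<Rightarrow> 'a fps poly" where "T r = Polynomial.smult (fps_const ((-1) ^ r / fact r)) (monom 1 r)" for r
  have strip: "log_strip V i = (\<Sum>r\<le>i. V (i - r) * T r)" for V i
    by (simp add: log_strip_def T_def)
  have T0: "theta_log (T 0) = 0"
    by (simp add: T_def theta_log_smult)
  have TS: "theta_log (T (Suc r)) = - T r" for r
  proof -
    have "theta_log (monom (1::'a fps) (Suc r)) = monom (of_nat (Suc r)) r"
      by (simp add: theta_log_def map_poly_monom pderiv_monom)
    moreover have "fps_const ((-1) ^ Suc r / fact (Suc r)) * of_nat (Suc r) = - fps_const ((-1) ^ r / fact r :: 'a)"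
      by (simp add: fps_of_nat[symmetric] field_simps del: of_nat_Suc)
    ultimately show ?thesis
      unfolding T_def theta_log_smult by (simp add: smult_monom minus_monom)
  qed
  have "theta_log (log_strip V (Suc i)) = (\<Sum>r\<le>Suc i. theta_log (V (Suc i - r)) * T r) +
          (\<Sum>r\<le>Suc i. V (Suc i - r) * theta_log (T r))"
    by (simp only: strip theta_log_sum theta_log_mult sum.distrib)
  also have "(\<Sum>r\<le>Suc i. V (Suc i - r) * theta_log (T r)) = - (\<Sum>r\<le>i. V (i - r) * T r)"
    by (subst sum.atMost_Suc_shift) (simp add: T0 TS sum_negf)
  finally show ?thesis by (simp only: strip diff_conv_add_uminus)
qed

lemma log_strip_shift:
  assumes "V 0 = 0"
  shows "log_strip V (Suc i) = log_strip (\<lambda>m. V (Suc m)) i"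
  using assms by (simp add: log_strip_def Suc_diff_le)

text \<open>When \<open>V 0\<close> is killed by theta, the derived sequence starts with zero and
  may be shifted. If stripping \<open>V\<close> leaves no logarithms, the same then holds for the
  shifted derived sequence.\<close>

lemma log_strip_step:
  assumes "theta_log (V 0) = 0"
  shows "log_strip (\<lambda>m. theta_log (V (Suc m))) i = theta_log (log_strip V (Suc i)) + log_strip V i"
  using theta_log_log_strip[of V i] log_strip_shift[of "\<lambda>m. theta_log (V m)"] assms by simp

lemma degree_theta_log_0: "degree p = 0 \<Longrightarrow> degree (theta_log p) = 0"
  by (metis degree_0_id degree_pCons_0 theta_log_simps(3))

section \<open>Existence and uniqueness of the factorization\<close>

lemma fps_mult_inverse: "fps_nth h 0 = 1 \<Longrightarrow> inverse h * h = (1 :: 'a::field fps)"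
  by (rule inverse_mult_eq_1) simp

lemma fps_prod_nth_0:
  "(\<And>j. j \<in> S \<Longrightarrow> fps_nth (f j) 0 = 1) \<Longrightarrow> fps_nth (\<Prod>j\<in>S. f j) 0 = (1 :: 'a::field)"
  by (induction S rule: infinite_finite_induct) auto

text \<open>The second conjunct is the induction invariant: the images of \<open>F k\<close>,
  \<open>F (k + 1)\<close>, ... under the chain again form a Frobenius-type sequence, starting with
  1. Differentiating and dividing by the new first term extends the chain.\<close>

lemma polya_chain_exists:
  assumes "F 0 = [:F0:]" "fps_nth F0 0 = 1"
    and "\<And>i. i < n \<Longrightarrow> degree (log_strip F i) = 0"
    and "k < n"
  shows "\<exists>A. (\<forall>j\<le>k. fps_nth (A j) 0 = 1 \<and> chain_app A j (F j) = 1) \<and>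
             (\<forall>i. i + k < n \<longrightarrow> degree (log_strip (\<lambda>m. chain_app A k (F (m + k))) i) = 0)"
  using assms(4)
proof (induction k)
  case 0
  have "degree (log_strip (\<lambda>m. [:inverse F0:] * F m) i) = 0" if "i < n" for i
    using assms(3)[OF that] by (simp only: log_strip_const_mult) simp
  then show ?case
    by (intro exI[of _ "\<lambda>_. inverse F0"]) (simp add: assms fps_mult_inverse[of F0] one_pCons mult.commute[of F0])
next
  case (Suc k)
  then obtain A where A: "\<And>j. j \<le> k \<Longrightarrow> fps_nth (A j) 0 = 1" "\<And>j. j \<le> k \<Longrightarrow> chain_app A j (F j) = 1"
    and deg: "\<And>i. i + k < n \<Longrightarrow> degree (log_strip (\<lambda>m. chain_app A k (F (m + k))) i) = 0"
    by auto
  define V where "V m = chain_app A k (F (m + k))" for m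
  have V0: "V 0 = 1" by (simp add: V_def A)
  have step: "log_strip (\<lambda>m. theta_log (V (Suc m))) i = theta_log (log_strip V (Suc i)) + log_strip V i" for i
    by (rule log_strip_step) (simp add: V0)
  have deg': "degree (log_strip (\<lambda>m. theta_log (V (Suc m))) i) = 0" if "i + Suc k < n" for i
  proof -
    have "degree (theta_log (log_strip V (Suc i))) = 0"
      using deg[of "Suc i"] that by (intro degree_theta_log_0) (simp add: V_def[abs_def])
    moreover have "degree (log_strip V i) = 0"
      using deg[of i] that by (simp add: V_def[abs_def])
    ultimately show ?thesis
      unfolding step using degree_add_le[of _ 0] by fastforce
  qed
  \<comment> \<open>Since \<open>V 0 = 1\<close>, this says \<open>V 1 = g + log t\<close>, so the
    derivative of \<open>V 1\<close> is a power series with constant term 1 and can be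
    inverted.\<close>
  obtain g where "log_strip V 1 = [:g:]"
  proof -
    have "degree (log_strip V 1) = 0"
      using deg[of 1] Suc.prems by (simp add: V_def[abs_def])
    with that show ?thesis by (metis degree_0_id)
  qed
  then have "theta_log (V 1) = [:theta g:] + [:1:]"
    using step[of 0] V0 unfolding log_strip_0 One_nat_def by (simp only: theta_log_simps one_pCons)
  then have "theta_log (V 1) = [:theta g + 1:]" by simp
  then obtain h where h: "theta_log (V 1) = [:h:]" "fps_nth h 0 = 1"
    using that[of "theta g + 1"] by simp
  define B where "B = A(Suc k := inverse h)"
  have B: "chain_app B j f = chain_app A j f" if "j \<le> k" for j f
    using that by (intro chain_app_cong) (auto simp: B_def)
  have BS: "chain_app B (Suc k) (F (m + Suc k)) = [:inverse h:] * theta_log (V (Suc m))" for m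
    unfolding chain_app.simps B[OF order_refl] by (simp add: V_def B_def)
  have "chain_app B (Suc k) (F (Suc k)) = 1"
    using BS[of 0] h fps_mult_inverse[of h] by (simp add: mult.commute[of h])
  moreover have "fps_nth (B (Suc k)) 0 = 1"
    using h by (simp add: B_def)
  moreover have "fps_nth (B j) 0 = 1 \<and> chain_app B j (F j) = 1" if "j \<le> k" for j
    using A that by (simp add: B) (simp add: B_def)
  ultimately have "\<forall>j\<le>Suc k. fps_nth (B j) 0 = 1 \<and> chain_app B j (F j) = 1"
    by (metis le_Suc_eq)
  moreover have "degree (log_strip (\<lambda>m. chain_app B (Suc k) (F (m + Suc k))) i) = 0" if "i + Suc k < n" for i
    unfolding BS log_strip_const_mult using deg'[OF that] by simp
  ultimately show ?case by blast
qed

text \<open>Vanishing on \<open>F 0, \<dots>, F (k - 1)\<close> determines operators of order less than \<open>k\<close>,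
  because the values of \<open>theta_chain A\<close> on the \<open>F r\<close> form a unitriangular matrix.\<close>
lemma operator_eq_0:
  assumes "\<And>j. j < k \<Longrightarrow> fps_nth (A j) 0 = 1" "\<And>j. j < k \<Longrightarrow> chain_app A j (F j) = 1"
    and "\<And>r. r \<ge> k \<Longrightarrow> coeff p r = 0" "\<And>r. r < k \<Longrightarrow> apply_op p (F r) = 0"
  shows "p = 0"
  using assms
proof (induction k arbitrary: p)
  case 0
  then show ?case by (simp add: poly_eq_iff)
next
  case (Suc k)
  define P where "P = (\<Prod>j\<le>k. A j)"
  have "fps_nth P 0 = 1"
    unfolding P_def by (rule fps_prod_nth_0) (simp add: Suc.prems(1))
  \<comment> \<open>The chain of length \<open>k\<close> has leading coefficient \<open>P\<close>,
    so this multiple of it cancels the top term of \<open>p\<close>; evaluation at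
    \<open>F k\<close> will force \<open>c\<close> to vanish.\<close>
  define c where "c = inverse P * coeff p k"
  define q where "q = p - Polynomial.smult c (theta_chain A k)"
  have "coeff q r = 0" if "r \<ge> k" for r
  proof (cases "r = k")
    case True
    have "c * P = inverse P * P * coeff p k" by (simp add: c_def mult_ac)
    then show ?thesis using True fps_mult_inverse[OF \<open>fps_nth P 0 = 1\<close>]
      by (simp add: q_def lead_coeff_theta_chain P_def[symmetric])
  qed (use that Suc.prems(3) in \<open>simp add: q_def coeff_theta_chain_eq_0\<close>)
  moreover have "apply_op q (F r) = 0" if "r < k" for r
    using that Suc.prems(4)[of r] chain_app_zero_mono[of A r "F r" k] Suc.prems(2)[of r]
    by (simp add: q_def apply_op_diff apply_op_smult apply_op_theta_chain)
  ultimately have "q = 0"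
    by (rule Suc.IH[rotated 2]) (simp_all add: Suc.prems(1,2))
  then have p: "p = Polynomial.smult c (theta_chain A k)" by (simp add: q_def)
  have "apply_op p (F k) = [:c:]"
    using Suc.prems(2)[of k] by (simp add: p apply_op_smult apply_op_theta_chain one_pCons)
  then have "c = 0" using Suc.prems(4)[of k] by simp
  then show ?case by (simp add: p)
qed

lemma polya_factorization:
  assumes "0 < n" "frobenius_basis n a F"
  obtains A where "\<And>j. j \<le> n \<Longrightarrow> fps_nth (A j) 0 = 1" "\<And>j. j < n \<Longrightarrow> chain_app A j (F j) = 1"
    "theta_chain A n = L_op n a"
proof -
  obtain F0 where F0: "F 0 = [:F0:]" "fps_nth F0 0 = 1"
    using assms(2) by (auto simp: frobenius_basis_def)
  have deg: "degree (log_strip F i) = 0" if "i < n" for i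
    using assms(2) that F0 by (cases "i = 0") (auto simp: frobenius_basis_def log_strip_def)
  obtain B where B: "\<And>j. j < n \<Longrightarrow> fps_nth (B j) 0 = 1" "\<And>j. j < n \<Longrightarrow> chain_app B j (F j) = 1"
  proof -
    have "n - 1 < n" and less: "j \<le> n - 1" if "j < n" for j using assms(1) that by auto
    from polya_chain_exists[of F F0 n "n - 1", OF F0 deg] assms(1) obtain B
      where "\<forall>j\<le>n - 1. fps_nth (B j) 0 = 1 \<and> chain_app B j (F j) = 1" by auto
    with less show ?thesis by (intro that[of B]) blast+
  qed
  define P where "P = (\<Prod>j<n. B j)"
  have P: "fps_nth P 0 = 1" unfolding P_def by (rule fps_prod_nth_0) (simp add: B(1))
  \<comment> \<open>The last factor makes the full chain monic. Its difference from
    \<open>L_op n a\<close> then has order below \<open>n\<close> and kills all \<open>F r\<close>,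
    hence vanishes.\<close>
  define A where "A = B(n := inverse P)"
  have A1: "fps_nth (A j) 0 = 1" if "j \<le> n" for j
    using that B(1) P by (cases "j = n") (auto simp: A_def)
  have A2: "chain_app A j (F j) = 1" if "j < n" for j
    using B(2)[OF that] chain_app_cong[of j A B] that by (simp add: A_def)
  have "(\<Prod>j<n. A j) = P" unfolding P_def by (rule prod.cong) (auto simp: A_def)
  then have top: "(\<Prod>j\<le>n. A j) = 1"
    using fps_mult_inverse[OF P] by (simp add: lessThan_Suc_atMost[symmetric] A_def mult.commute)
  have "theta_chain A n - L_op n a = 0"
  proof (rule operator_eq_0[where k = n and A = A and F = F])
    fix r assume "n \<le> r"
    then show "coeff (theta_chain A n - L_op n a) r = 0"
      by (cases "r = n") (auto simp: lead_coeff_theta_chain top coeff_L_op coeff_theta_chain_eq_0)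
  next
    fix r assume r: "r < n"
    have "chain_app A n (F r) = 0"
      using r A2[OF r] by (intro chain_app_zero_mono[of A r]) auto
    then show "apply_op (theta_chain A n - L_op n a) (F r) = 0"
      using assms(2) r by (simp add: apply_op_diff apply_op_theta_chain frobenius_basis_def)
  qed (use A1 A2 in auto)
  with A1 A2 show ?thesis by (intro that) auto
qed

text \<open>If the factors before \<open>k\<close> agree, the two chains at \<open>F k\<close>
  differ by the ratio \<open>g\<close> of the factors at \<open>k\<close>. The longer chain kills
  \<open>F k\<close>, so \<open>chain_app_kernel\<close> makes \<open>g\<close> constant, and
  normalization makes it 1.\<close>

lemma chain_unique:
  assumes "\<And>j. j \<le> n \<Longrightarrow> fps_nth (A j) 0 = 1" "\<And>j. j \<le> n \<Longrightarrow> fps_nth (B j) 0 = 1"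
    and "\<And>j. j < n \<Longrightarrow> chain_app A j (F j) = 1" "\<And>r. r < n \<Longrightarrow> chain_app B n (F r) = 0"
    and "k < n"
  shows "B k = A k"
  using assms(5)
proof (induction k rule: less_induct)
  case (less k)
  define g where "g = B k * inverse (A k)"
  have inv: "inverse (A k) * A k = 1"
    using less.prems by (intro fps_mult_inverse assms(1)) simp
  have BA: "B k = g * A k"
    using inv by (simp add: g_def mult.assoc)
  have "chain_app B k (F k) = [:g:] * chain_app A k (F k)"
  proof (cases k)
    case (Suc i)
    have "chain_app B i (F k) = chain_app A i (F k)"
      using less Suc by (intro chain_app_cong) auto
    then show ?thesis using BA by (simp add: Suc mult.commute)
  qed (use BA in \<open>simp add: mult.commute\<close>)
  then have "chain_app B k (F k) = [:g:]"
    using assms(3)[OF less.prems] by simp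
  then obtain d where d: "g = fps_const d"
    using chain_app_kernel[of B n "F k" 0 k g] assms(2) assms(4)[OF less.prems] less.prems by auto
  have "fps_nth g 0 = 1"
    using assms(1,2)[of k] less.prems by (simp add: g_def)
  with d BA show ?case by simp
qed

section \<open>Wronskians and the symmetry of the factors\<close>

text \<open>The Wronskian matrix times the upper triangular matrix of chain coefficients is the
  matrix of values of the chains on the \<open>F r\<close>, which is lower triangular with ones on
  the diagonal.\<close>

lemma wronsk_chain:
  assumes "\<And>j. j < n \<Longrightarrow> chain_app A j (F j) = 1" "k \<le> n"
  shows "wronsk F k * (\<Prod>j<k. [:\<Prod>i\<le>j. A i:]) = 1"
proof -
  define M where "M = mat k k (\<lambda>(r, s). (theta_log ^^ s) (F r))"
  define T where "T = mat k k (\<lambda>(s, j). [:coeff (theta_chain A j) s:])"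
  have MT: "(M * T) $$ (r, j) = chain_app A j (F r)" if "r < k" "j < k" for r j
  proof -
    have "(M * T) $$ (r, j) = (\<Sum>s<k. [:coeff (theta_chain A j) s:] * (theta_log ^^ s) (F r))"
      using that by (simp add: M_def T_def scalar_prod_def lessThan_atLeast0)
    also have "\<dots> = (\<Sum>s\<le>k - 1. [:coeff (theta_chain A j) s:] * (theta_log ^^ s) (F r))"
      using that by (intro sum.cong) auto
    also have "\<dots> = apply_op (theta_chain A j) (F r)"
      using that degree_theta_chain[of A j] by (intro apply_op_eq_sum[symmetric]) auto
    finally show ?thesis by (simp add: apply_op_theta_chain)
  qed
  have dims: "M \<in> carrier_mat k k" "T \<in> carrier_mat k k"
    by (auto simp: M_def T_def)
  have "det (M * T) = prod_list (diag_mat (M * T))"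
  proof (rule det_lower_triangular[of k])
    fix i j assume "i < j" "j < k"
    then show "(M * T) $$ (i, j) = 0"
      using assms chain_app_zero_mono[of A i "F i" j] by (simp add: MT)
  qed (use dims in auto)
  also have "\<dots> = (\<Prod>i = 0..<k. (M * T) $$ (i, i))"
    using dims by (simp add: prod_list_diag_prod)
  also have "\<dots> = 1"
    using assms by (intro prod.neutral) (simp add: MT)
  finally have "det M * det T = 1" using det_mult[OF dims] by simp
  moreover have "det T = (\<Prod>j<k. [:\<Prod>i\<le>j. A i:])"
  proof -
    have "det T = prod_list (diag_mat T)"
      by (rule det_upper_triangular[of _ k]) (auto simp: T_def coeff_theta_chain_eq_0)
    also have "\<dots> = (\<Prod>j<k. [:\<Prod>i\<le>j. A i:])"
      by (simp add: prod_list_diag_prod T_def lead_coeff_theta_chain lessThan_atLeast0)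
    finally show ?thesis .
  qed
  ultimately show ?thesis by (simp add: wronsk_def M_def)
qed

lemma wronsk_Suc:
  assumes "\<And>j. j < n \<Longrightarrow> chain_app A j (F j) = 1" "k < n"
  shows "wronsk F k = [:\<Prod>i\<le>k. A i:] * wronsk F (Suc k)"
proof -
  define Q where "Q = (\<Prod>j<k. [:\<Prod>i\<le>j. A i:])"
  define c where "c = [:\<Prod>i\<le>k. A i:]"
  have "wronsk F k * Q = 1" "wronsk F (Suc k) * (Q * c) = 1"
    using wronsk_chain[of n A F k] wronsk_chain[of n A F "Suc k"] assms by (simp_all add: Q_def c_def)
  then have "wronsk F k = wronsk F k * (wronsk F (Suc k) * (Q * c))" by simp
  also have "\<dots> = (wronsk F k * Q) * (c * wronsk F (Suc k))" by (simp only: mult_ac)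
  finally show ?thesis using \<open>wronsk F k * Q = 1\<close> by (simp add: c_def)
qed

text \<open>By self-adjointness the reversed chain, with \<open>\<beta>\<close> absorbed into its innermost factor, also
  annihilates the \<open>F r\<close>.\<close>
lemma chain_symmetric:
  assumes "self_adjoint n a \<beta>" "fps_nth \<beta> 0 = 1" "theta_chain A n = L_op n a"
    and "\<And>r. r < n \<Longrightarrow> apply_op (L_op n a) (F r) = 0"
    and "\<And>j. j \<le> n \<Longrightarrow> fps_nth (A j) 0 = 1" "\<And>j. j < n \<Longrightarrow> chain_app A j (F j) = 1"
    and "k < n"
  shows "A k = (if k = 0 then A n * \<beta> else A (n - k))"
proof -
  define B where "B = (\<lambda>j. A (n - j))(0 := A n * \<beta>)"
  have "B k = A k"
  proof (rule chain_unique[where n = n and F = F])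
    fix r assume r: "r < n"
    \<comment> \<open>The adjoint is evaluated at \<beta> times \<open>F r\<close>, so that the
      inner factor of the conjugation cancels and a solution of the operator remains.\<close>
    have inv: "[:inverse \<beta>:] * ([:\<beta>:] * F r) = F r"
      using fps_mult_inverse[OF assms(2)] by (simp add: mult.commute)
    have "(-1) ^ n * chain_app B n (F r) = adjoint_app (L_op n a) ([:\<beta>:] * F r)"
      by (simp only: assms(3)[symmetric] adjoint_app_theta_chain chain_app_const_mult B_def diff_zero)
    also have "\<dots> = apply_op (adjoint (L_op n a)) ([:\<beta>:] * F r)"
      by (simp only: apply_op_adjoint)
    also have "\<dots> = 0"
      unfolding assms(1)[unfolded self_adjoint_def] apply_op_smult apply_op_dop_mult apply_op_const inv
        assms(4)[OF r] by simp
    finally show "chain_app B n (F r) = 0" by simp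
  qed (use assms in \<open>auto simp: B_def\<close>)
  then show ?thesis by (auto simp: B_def)
qed

section \<open>Flags of submodules spanned by a triangular basis\<close>

lemma theta_lam_sum:
  "theta_lam n a (\<lambda>r. \<Sum>j<m. c j * u j r) =
     (\<lambda>r. if r < n then \<Sum>j<m. theta (c j) * u j r + c j * theta_lam n a (u j) r else 0)"
  by (auto simp: fun_eq_iff theta_lam_def theta_sum theta_mult sum.distrib sum_subtractf
      sum_distrib_left algebra_simps)

text \<open>Isolates what the filtration argument uses: triangularity against \<open>Fil\<close>
  with unit leading coefficients, and a single theta-string with unit multipliers.\<close>

locale flag_basis =
  fixes n :: nat and a :: "nat \<Rightarrow> 'a::field_char_0 fps"
    and u :: "nat \<Rightarrow> nat \<Rightarrow> 'a fps" and \<tau> :: "nat \<Rightarrow> 'a fps"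
  assumes upper_zero: "\<And>i r. i < n \<Longrightarrow> n - 1 - i < r \<Longrightarrow> u i r = 0"
    and lead_unit: "\<And>i. i < n \<Longrightarrow> fps_nth (u i (n - 1 - i)) 0 \<noteq> 0"
    and theta_0: "theta_lam n a (u 0) = (\<lambda>r. 0)"
    and theta_Suc: "\<And>i. Suc i < n \<Longrightarrow> theta_lam n a (u (Suc i)) = (\<lambda>r. \<tau> (Suc i) * u i r)"
    and \<tau>_unit: "\<And>i. Suc i < n \<Longrightarrow> fps_nth (\<tau> (Suc i)) 0 \<noteq> 0"
begin

definition lincomb :: "nat \<Rightarrow> (nat \<Rightarrow> 'a fps) \<Rightarrow> nat \<Rightarrow> 'a fps" where
  "lincomb m c = (\<lambda>r. \<Sum>j<m. c j * u j r)"

text \<open>The index counts generators: \<open>flag (Suc i)\<close> is \<open>U\<^sub>i\<close>,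
  and \<open>flag 0\<close> is the zero module below \<open>U\<^sub>0\<close>.\<close>

definition flag :: "nat \<Rightarrow> (nat \<Rightarrow> 'a fps) set" where
  "flag m = range (lincomb m)"

lemma flagI: "x = lincomb m c \<Longrightarrow> x \<in> flag m"
  by (simp add: flag_def)

lemma flag_0: "flag 0 = {\<lambda>r. 0}"
  by (auto simp: flag_def lincomb_def)

lemma lincomb_lam: "m \<le> n \<Longrightarrow> lincomb m c \<in> lam n"
  by (auto simp: lincomb_def lam_def upper_zero intro!: sum.neutral)

lemma lincomb_extend:
  assumes "m \<le> k"
  shows "lincomb m c = lincomb k (\<lambda>j. if j < m then c j else 0)"
  unfolding lincomb_def using assms by (intro ext sum.mono_neutral_cong_left) auto

lemma flag_mono: "m \<le> k \<Longrightarrow> flag m \<subseteq> flag k"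
  using lincomb_extend by (auto simp: flag_def)

text \<open>Back substitution: \<open>u m\<close> vanishes above coordinate \<open>n - 1 - m\<close>
  and is a unit there, so adding a multiple of it corrects one more coordinate and keeps the earlier
  ones.\<close>

lemma lincomb_approx:
  assumes "v \<in> lam n" "m \<le> n"
  shows "\<exists>c. \<forall>r\<ge>n - m. v r = lincomb m c r"
  using assms(2)
proof (induction m)
  case 0
  then show ?case using assms(1) by (simp add: lam_def lincomb_def)
next
  case (Suc m)
  then obtain c where c: "v r = lincomb m c r" if "r \<ge> n - m" for r by auto
  define x where "x = u m (n - 1 - m)"
  define d where "d = inverse x * (v (n - 1 - m) - lincomb m c (n - 1 - m))"
  have "x * inverse x = 1"
    using lead_unit[of m] Suc.prems by (simp add: x_def inverse_mult_eq_1')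
  then have d: "d * x = v (n - 1 - m) - lincomb m c (n - 1 - m)"
    by (simp add: d_def mult_ac)
  have split: "lincomb (Suc m) (c(m := d)) r = lincomb m c r + d * u m r" for r
    by (simp add: lincomb_def)
  have "v r = lincomb (Suc m) (c(m := d)) r" if r: "r \<ge> n - Suc m" for r
  proof (cases "r = n - 1 - m")
    case True
    then show ?thesis using d unfolding split x_def by simp
  next
    case False
    then show ?thesis using c[of r] r Suc.prems upper_zero[of m r] unfolding split by simp
  qed
  then show ?case by blast
qed

text \<open>Only the top \<open>m\<close> coordinates are assumed to vanish; this is stronger than
  linear independence and makes the intersection with \<open>Fil n m\<close> zero.\<close>

lemma lincomb_indep:
  assumes "m \<le> n" "\<And>r. r \<ge> n - m \<Longrightarrow> lincomb m c r = 0" "j < m"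
  shows "c j = 0"
  using assms
proof (induction m arbitrary: j)
  case (Suc m)
  have split: "lincomb (Suc m) c r = lincomb m c r + c m * u m r" for r
    by (simp add: lincomb_def)
  have "lincomb m c r = 0" if "r \<ge> n - m" for r
    using Suc.prems(1) Suc.prems(2)[of r] upper_zero[of m r] that unfolding split by simp
  with Suc.IH Suc.prems(1) have IH: "c i = 0" if "i < m" for i using that by simp
  then have "lincomb m c r = 0" for r by (simp add: lincomb_def)
  then have "c m * u m (n - 1 - m) = 0"
    using Suc.prems(2)[of "n - 1 - m"] split by simp
  moreover have "u m (n - 1 - m) \<noteq> 0"
    using lead_unit[of m] Suc.prems(1) by auto
  ultimately show ?case using IH Suc.prems(3) by (auto simp: less_Suc_eq)
qed simp

lemma lam_lincomb:
  assumes "v \<in> lam n"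
  obtains c where "v = lincomb n c"
  using lincomb_approx[OF assms order_refl] by auto

lemma lincomb_diff: "lincomb m (\<lambda>j. c j - d j) = (\<lambda>r. lincomb m c r - lincomb m d r)"
  by (simp add: lincomb_def algebra_simps sum_subtractf)

lemma flag_diff: "x \<in> flag m \<Longrightarrow> y \<in> flag m \<Longrightarrow> (\<lambda>r. x r - y r) \<in> flag m"
  by (auto simp: flag_def lincomb_diff[symmetric])

lemma lincomb_in_flag_iff:
  assumes "m \<le> k" "k \<le> n"
  shows "lincomb k c \<in> flag m \<longleftrightarrow> (\<forall>j. m \<le> j \<and> j < k \<longrightarrow> c j = 0)"
proof
  assume "lincomb k c \<in> flag m"
  then obtain d where d: "lincomb k c = lincomb m d" by (auto simp: flag_def)
  define d' where "d' j = (if j < m then d j else 0)" for j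
  have "lincomb k (\<lambda>j. c j - d' j) = (\<lambda>r. lincomb k c r - lincomb k d' r)"
    by (rule lincomb_diff)
  also have "\<dots> = (\<lambda>r. 0)"
    using lincomb_extend[OF assms(1), of d] d by (simp add: d'_def[abs_def])
  finally have "c j - d' j = 0" if "j < k" for j
    using lincomb_indep[OF assms(2), of "\<lambda>j. c j - d' j" j] that by (simp add: fun_eq_iff)
  then show "\<forall>j. m \<le> j \<and> j < k \<longrightarrow> c j = 0" by (auto simp: d'_def)
next
  assume *: "\<forall>j. m \<le> j \<and> j < k \<longrightarrow> c j = 0"
  have "lincomb k c = lincomb m c"
    unfolding lincomb_def using * assms(1) by (intro ext sum.mono_neutral_right) auto
  then show "lincomb k c \<in> flag m" by (rule flagI)
qed

text \<open>Theta acts on coefficients in the basis \<open>u\<close> as the derivation plus a shift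
  weighted by \<tau>. This gives stability of the flag, and the relations from which its uniqueness
  follows.\<close>

lemma theta_lincomb:
  assumes "m \<le> n"
  shows "theta_lam n a (lincomb m c) =
    lincomb m (\<lambda>j. theta (c j) + (if Suc j < m then c (Suc j) * \<tau> (Suc j) else 0))"
proof
  fix r
  have *: "(\<Sum>j<m. c j * theta_lam n a (u j) r) =
           (\<Sum>j<m. (if Suc j < m then c (Suc j) * \<tau> (Suc j) else 0) * u j r)"
  proof (cases m)
    case (Suc k)
    then have "(\<Sum>j<m. c j * theta_lam n a (u j) r) = (\<Sum>j<k. c (Suc j) * \<tau> (Suc j) * u j r)"
      unfolding Suc sum.lessThan_Suc_shift using assms Suc by (simp add: theta_0) (intro sum.cong; simp add: theta_Suc mult.assoc)
    then show ?thesis by (simp add: Suc)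
  qed simp
  show "theta_lam n a (lincomb m c) r =
    lincomb m (\<lambda>j. theta (c j) + (if Suc j < m then c (Suc j) * \<tau> (Suc j) else 0)) r"
  proof (cases "r < n")
    case True
    then show ?thesis
      unfolding lincomb_def theta_lam_sum by (simp add: sum.distrib * distrib_right)
  next
    case False
    then show ?thesis
      using lincomb_lam[OF assms] by (simp add: theta_lam_def lam_def)
  qed
qed

lemma submod_flag:
  assumes "m \<le> n"
  shows "submod n a (flag m)"
  unfolding submod_def
proof (intro conjI ballI allI)
  show "flag m \<subseteq> lam n" using lincomb_lam[OF assms] by (auto simp: flag_def)
  show "(\<lambda>r. 0) \<in> flag m" by (rule flagI[where c = "\<lambda>_. 0"]) (simp add: lincomb_def)
  fix x assume "x \<in> flag m"
  then obtain c where c: "x = lincomb m c" by (auto simp: flag_def)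
  show "theta_lam n a x \<in> flag m"
    unfolding c theta_lincomb[OF assms] by (simp add: flag_def)
  show "(\<lambda>r. d * x r) \<in> flag m" for d
    by (rule flagI[where c = "\<lambda>j. d * c j"]) (simp add: c lincomb_def sum_distrib_left mult.assoc)
  fix y assume "y \<in> flag m"
  then obtain d where d: "y = lincomb m d" by (auto simp: flag_def)
  show "(\<lambda>r. x r + y r) \<in> flag m"
    by (rule flagI[where c = "\<lambda>j. c j + d j"]) (simp add: c d lincomb_def sum.distrib distrib_right)
qed

lemma flag_Int_Fil:
  assumes "m \<le> n"
  shows "flag m \<inter> Fil n m = {\<lambda>r. 0}"
proof -
  have "x = (\<lambda>r. 0)" if "x \<in> flag m" "x \<in> Fil n m" for x
  proof -
    obtain c where c: "x = lincomb m c" using \<open>x \<in> flag m\<close> by (auto simp: flag_def)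
    have "c j = 0" if "j < m" for j
      using lincomb_indep[OF assms, of c j] that \<open>x \<in> Fil n m\<close> by (simp add: Fil_def c)
    then show ?thesis by (simp add: c lincomb_def)
  qed
  moreover have "(\<lambda>r. 0) \<in> flag m" using submod_flag[OF assms] by (simp add: submod_def)
  moreover have "(\<lambda>r. 0) \<in> Fil n m" by (simp add: Fil_def lam_def)
  ultimately show ?thesis by blast
qed

lemma direct_sum_flag:
  assumes "m \<le> n"
  shows "direct_sum n (flag m) (Fil n m)"
  unfolding direct_sum_def
proof (intro conjI ballI flag_Int_Fil assms)
  fix v :: "nat \<Rightarrow> 'a fps" assume v: "v \<in> lam n"
  obtain c where c: "\<And>r. r \<ge> n - m \<Longrightarrow> v r = lincomb m c r"
    using lincomb_approx[OF v assms] by auto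
  have "(\<lambda>r. v r - lincomb m c r) \<in> Fil n m"
    using c by (auto simp: Fil_def lam_def)
  moreover have "lincomb m c \<in> flag m" by (simp add: flag_def)
  ultimately show "\<exists>x\<in>flag m. \<exists>w\<in>Fil n m. v = (\<lambda>r. x r + w r)"
    by (intro bexI[of _ "lincomb m c"] bexI[of _ "\<lambda>r. v r - lincomb m c r"]) auto
qed

lemma u_eq_lincomb: "i < m \<Longrightarrow> u i = lincomb m (\<lambda>j. if j = i then 1 else 0)"
  by (auto simp: lincomb_def fun_eq_iff if_distrib[of "\<lambda>x. x * _"] cong: if_cong)

lemma trivial_quotient_flag:
  assumes "i < n"
  shows "trivial_quotient n a (flag (Suc i)) (flag i)"
  unfolding trivial_quotient_def
proof (intro exI[of _ "[u i]"] conjI)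
  show "set [u i] \<subseteq> flag (Suc i)"
    using u_eq_lincomb[of i "Suc i"] by (simp add: flag_def)
  have "theta_lam n a (u i) \<in> flag i"
  proof (cases i)
    case (Suc k)
    then show ?thesis using assms
      by (intro flagI[where c = "\<lambda>j. if j = k then \<tau> i else 0"])
        (auto simp: theta_Suc lincomb_def fun_eq_iff if_distrib[of "\<lambda>x. x * _"] cong: if_cong)
  qed (simp add: theta_0 flag_0)
  then show "\<forall>w\<in>set [u i]. theta_lam n a w \<in> flag i" by simp
  show "\<forall>m\<in>flag (Suc i). \<exists>c. (\<lambda>r. m r - (\<Sum>j<length [u i]. c j * ([u i] ! j) r)) \<in> flag i"
  proof
    fix x assume "x \<in> flag (Suc i)"
    then obtain c where "x = lincomb (Suc i) c" by (auto simp: flag_def)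
    then have "(\<lambda>r. x r - c i * u i r) = lincomb i c" by (simp add: lincomb_def)
    then show "\<exists>c. (\<lambda>r. x r - (\<Sum>j<length [u i]. c j * ([u i] ! j) r)) \<in> flag i"
      by (intro exI[of _ "\<lambda>_. c i"]) (simp add: flag_def)
  qed
  show "\<forall>c. (\<lambda>r. \<Sum>j<length [u i]. c j * ([u i] ! j) r) \<in> flag i \<longrightarrow> (\<forall>j<length [u i]. c j = 0)"
  proof (intro allI impI)
    fix c j assume *: "(\<lambda>r. \<Sum>j<length [u i]. c j * ([u i] ! j) r) \<in> flag i" "j < length [u i]"
    define d where "d j = (if j = i then c 0 else 0)" for j
    have "(\<lambda>r. \<Sum>j<length [u i]. c j * ([u i] ! j) r) = lincomb (Suc i) d"
      by (auto simp: lincomb_def d_def fun_eq_iff)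
    with * lincomb_in_flag_iff[of i "Suc i" d] assms have "d i = 0" by simp
    with * show "c j = 0" by (simp add: d_def)
  qed
qed

lemma admissible_flag: "admissible_filtration n a (\<lambda>i. flag (Suc i))"
proof -
  have "(if i = 0 then {\<lambda>r. 0} else flag (Suc (i - 1))) = flag i" for i
    by (simp add: flag_0)
  then show ?thesis
    unfolding admissible_filtration_def
    by (simp add: submod_flag flag_mono direct_sum_flag trivial_quotient_flag)
qed

text \<open>The successive coefficients above index \<open>m\<close> are killed from the top down: each is a
  constant because its derivative vanishes, and that constant is \<open>0\<close> because it
  is a unit multiple of a derivative.\<close>
lemma theta_in_flag_imp:
  assumes "v \<in> lam n" "m < n" "theta_lam n a v \<in> flag m"
  shows "v \<in> flag (Suc m)"
proof -
  obtain c where c: "v = lincomb n c" using lam_lincomb[OF assms(1)] .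
  have rel: "theta (c j) + (if Suc j < n then c (Suc j) * \<tau> (Suc j) else 0) = 0" if "m \<le> j" "j < n" for j
    using assms(2,3) that lincomb_in_flag_iff[of m n] unfolding c theta_lincomb[OF order_refl] by auto
  have const: "fps_nth (c j) 0 = 0" if "m < j" "j < n" for j
  proof -
    obtain i where i: "j = Suc i" using \<open>m < j\<close> by (cases j) auto
    then have "theta (c i) + c j * \<tau> j = 0" using rel[of i] that by simp
    then have "fps_nth (theta (c i) + c j * \<tau> j) 0 = 0" by simp
    then show ?thesis using \<tau>_unit[of i] that i by simp
  qed
  \<comment> \<open>Descending induction on the index \<open>n - d\<close>, starting at
    \<open>n - 1\<close>.\<close>
  have "c (n - d) = 0" if "m < n - d" "0 < d" for d
    using that
  proof (induction d)
    case (Suc d)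
    have "theta (c (n - Suc d)) = 0"
    proof (cases d)
      case 0
      then show ?thesis using rel[of "n - 1"] Suc.prems by simp
    next
      case (Suc e)
      with Suc.IH Suc.prems have "c (n - d) = 0" by simp
      moreover have "Suc (n - Suc d) = n - d" using Suc.prems by simp
      ultimately have "c (Suc (n - Suc d)) = 0" by (simp only:)
      then show ?thesis using rel[of "n - Suc d"] Suc.prems by (simp split: if_splits)
    qed
    with const[of "n - Suc d"] Suc.prems show ?case
      by (auto simp: theta_eq_0_iff)
  qed simp
  from this[of "n - j" for j] have "c j = 0" if "Suc m \<le> j" "j < n" for j
    using that by simp
  then show ?thesis
    unfolding c using assms(2) by (subst lincomb_in_flag_iff) auto
qed

text \<open>The generators of the trivial quotient are flat modulo \<open>flag i\<close>, hence lie
  in \<open>flag (Suc i)\<close> by \<open>theta_in_flag_imp\<close>. Equality follows because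
  nested complements of the same submodule coincide.\<close>

lemma admissible_step:
  assumes "submod n a M" "direct_sum n M (Fil n (Suc i))" "trivial_quotient n a M (flag i)" "i < n"
  shows "M = flag (Suc i)"
proof
  have sub: "submod n a (flag (Suc i))" using assms(4) by (intro submod_flag) simp
  then have add: "(\<lambda>r. x r + y r) \<in> flag (Suc i)" if "x \<in> flag (Suc i)" "y \<in> flag (Suc i)" for x y
    using that by (simp add: submod_def)
  have scale: "(\<lambda>r. c * x r) \<in> flag (Suc i)" if "x \<in> flag (Suc i)" for x c
    using that sub by (simp add: submod_def)
  have zero: "(\<lambda>r. 0) \<in> flag (Suc i)"
    using sub by (simp add: submod_def)
  show "M \<subseteq> flag (Suc i)"
  proof
    fix x assume x: "x \<in> M"
    obtain ws where ws: "set ws \<subseteq> M" "\<forall>w\<in>set ws. theta_lam n a w \<in> flag i"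
      "\<forall>x\<in>M. \<exists>c. (\<lambda>r. x r - (\<Sum>j<length ws. c j * (ws ! j) r)) \<in> flag i"
      using assms(3) unfolding trivial_quotient_def by blast
    obtain c where c: "(\<lambda>r. x r - (\<Sum>j<length ws. c j * (ws ! j) r)) \<in> flag i"
      using ws(3) x by blast
    have "M \<subseteq> lam n" using assms(1) by (simp add: submod_def)
    with ws have w: "ws ! j \<in> flag (Suc i)" if "j < length ws" for j
      using that assms(4) by (intro theta_in_flag_imp) (auto dest: nth_mem)
    have "(\<lambda>r. \<Sum>j<k. c j * (ws ! j) r) \<in> flag (Suc i)" if "k \<le> length ws" for k
      using that
    proof (induction k)
      case (Suc k)
      then show ?case using add[OF _ scale[OF w[of k], of "c k"]] by simp
    qed (simp add: zero)
    moreover have "(\<lambda>r. x r - (\<Sum>j<length ws. c j * (ws ! j) r)) \<in> flag (Suc i)"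
      using c flag_mono[of i "Suc i"] by auto
    ultimately show "x \<in> flag (Suc i)"
      using add by fastforce
  qed
  show "flag (Suc i) \<subseteq> M"
  proof
    fix x assume x: "x \<in> flag (Suc i)"
    with sub have "x \<in> lam n" by (auto simp: submod_def)
    then obtain y w where yw: "y \<in> M" "w \<in> Fil n (Suc i)" "x = (\<lambda>r. y r + w r)"
      using assms(2) unfolding direct_sum_def by blast
    have "(\<lambda>r. x r - y r) \<in> flag (Suc i)"
      using \<open>M \<subseteq> flag (Suc i)\<close> yw(1) by (intro flag_diff x) auto
    then have "w \<in> flag (Suc i)" using yw(3) by simp
    with yw(2) have "w = (\<lambda>r. 0)" using flag_Int_Fil[of "Suc i"] assms(4) by auto
    with yw show "x \<in> M" by simp
  qed
qed

lemma admissible_unique: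
  assumes "admissible_filtration n a U" "i < n"
  shows "U i = flag (Suc i)"
  using assms(2)
proof (induction i)
  case 0
  with assms(1) show ?case
    by (intro admissible_step) (auto simp: admissible_filtration_def flag_0)
next
  case (Suc i)
  with assms(1) show ?case
    by (intro admissible_step) (auto simp: admissible_filtration_def dest: spec[of _ "Suc i"])
qed

text \<open>An element of \<open>U\<^sub>i \<inter> Fil\<^sup>i\<close> is determined by its leading coefficient.\<close>
lemma good_sequence_unique:
  assumes "wronsk F i \<noteq> 0" "good_sequence n F \<beta> (\<lambda>i. flag (Suc i)) v"
    "good_sequence n F \<beta> (\<lambda>i. flag (Suc i)) w" "i < n"
  shows "v i = w i"
proof -
  have good: "x i \<in> lam n" "x i \<in> flag (Suc i)" "\<And>r. n - 1 - i < r \<Longrightarrow> x i r = 0"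
    "[:x i (n - 1 - i):] * wronsk F i = [:\<beta>:] * wronsk F (Suc i)"
    if "good_sequence n F \<beta> (\<lambda>i. flag (Suc i)) x" for x
  proof -
    have *: "x i \<in> lam n \<and> flag (Suc i) = {(\<lambda>r. \<Sum>j\<le>i. c j * x j r) | c. True} \<and>
      (\<forall>r. n - 1 - i < r \<longrightarrow> x i r = 0) \<and>
      [:x i (n - 1 - i):] * wronsk F i = [:\<beta>:] * wronsk F (Suc i)"
      using that assms(4) unfolding good_sequence_def by blast
    have "(\<lambda>r. \<Sum>j\<le>i. (if j = i then 1 else 0) * x j r) \<in> flag (Suc i)"
      unfolding *[THEN conjunct2, THEN conjunct1] 
      by (intro CollectI exI[of _ "\<lambda>j. if j = i then 1 else 0"] conjI refl TrueI)
    then show "x i \<in> flag (Suc i)"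
      by (simp add: if_distrib[of "\<lambda>y. y * _"] cong: if_cong)
    show "x i \<in> lam n" "\<And>r. n - 1 - i < r \<Longrightarrow> x i r = 0"
      "[:x i (n - 1 - i):] * wronsk F i = [:\<beta>:] * wronsk F (Suc i)" using * by blast+
  qed
  note v = good[OF assms(2)] and w = good[OF assms(3)]
  have "[:v i (n - 1 - i):] * wronsk F i = [:w i (n - 1 - i):] * wronsk F i"
    using v(4) w(4) by (simp only:)
  then have lead: "v i (n - 1 - i) = w i (n - 1 - i)"
    using assms(1) mult_cancel_right pCons_eq_iff by blast
  define d where "d = (\<lambda>r. v i r - w i r)"
  have "d \<in> flag (Suc i)"
    unfolding d_def using v(2) w(2) by (rule flag_diff)
  moreover have "d \<in> Fil n (Suc i)"
  proof -
    have "d r = 0" if "n - Suc i \<le> r" for r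
      using that lead v(3)[of r] w(3)[of r] by (cases "r = n - 1 - i") (auto simp: d_def)
    then show ?thesis by (simp add: Fil_def lam_def)
  qed
  ultimately have "d = (\<lambda>r. 0)" using flag_Int_Fil[of "Suc i"] assms(4) by auto
  then show ?thesis by (simp add: d_def fun_eq_iff)
qed

end

text \<open>Quotients are stated with denominators cleared. As \<open>log q\<close> is
  \<open>F 1 / F 0\<close>, the last clause is the quotient rule for its derivative.\<close>

theorem theorem1p4:
  fixes n :: nat and a :: "nat \<Rightarrow> 'a::field_char_0 fps" and \<beta> :: "'a fps"
    and F :: "nat \<Rightarrow> 'a fps poly"
  assumes "0 < n"
    and "calabi_yau n a \<beta>"
    and "beta_factor n a \<beta>" and "fps_nth \<beta> 0 = 1"
    and "frobenius_basis n a F"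
  shows "\<exists>U. admissible_filtration n a U \<and>
     (\<forall>U'. admissible_filtration n a U' \<longrightarrow> (\<forall>i<n. U' i = U i)) \<and>
     (\<exists>u. good_sequence n F \<beta> U u) \<and>
     (\<forall>u u'. good_sequence n F \<beta> U u \<and> good_sequence n F \<beta> U u' \<longrightarrow>
        (\<exists>c :: nat \<Rightarrow> 'a. \<forall>i<n. u' i = (\<lambda>r. fps_const (c i) * u i r))) \<and>
     (\<forall>u. good_sequence n F \<beta> U u \<longrightarrow>
        (\<exists>\<tau>. (\<forall>i. Suc i < n \<longrightarrow>
                [:\<tau> (Suc i):] * (wronsk F (Suc i))\<^sup>2 = wronsk F i * wronsk F (Suc (Suc i)) \<and>
                theta_lam n a (u (Suc i)) = (\<lambda>r. \<tau> (Suc i) * u i r)) \<and>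
             (1 < n \<longrightarrow> [:\<tau> 1:] * (F 0)\<^sup>2 = theta_log (F 1) * F 0 - F 1 * theta_log (F 0))))"
proof -
  obtain A where A: "\<And>j. j \<le> n \<Longrightarrow> fps_nth (A j) 0 = 1" "\<And>j. j < n \<Longrightarrow> chain_app A j (F j) = 1"
    and L: "theta_chain A n = L_op n a"
    using polya_factorization[OF assms(1,5)] by blast
  have sol: "apply_op (L_op n a) (F r) = 0" if "r < n" for r
    using assms(5) that by (simp add: frobenius_basis_def)
  have sym: "A k = (if k = 0 then A n * \<beta> else A (n - k))" if "k < n" for k
    using assms(2,4) L sol A that by (intro chain_symmetric[where F = F and a = a]) (auto simp: calabi_yau_def)
  define P where "P k = (\<Prod>j\<le>k. A j)" for k
  have P_unit: "fps_nth (P k) 0 = 1" if "k \<le> n" for k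
    unfolding P_def using that A(1) by (intro fps_prod_nth_0) auto
  have P_n: "P n = 1"
    using lead_coeff_theta_chain[of A n] by (simp add: P_def L coeff_L_op)
  have P_Suc: "P (Suc k) = P k * A (Suc k)" for k
    by (simp add: P_def)
  \<comment> \<open>By symmetry, raising \<open>i\<close> moves one factor from the second product
    to the first, so the value stays that at \<open>i = 0\<close>, where
    \<open>A 0 = A n * \<beta>\<close> and \<open>P n = 1\<close> give \<beta>.\<close>
  have PP: "P i * P (n - 1 - i) = \<beta>" if "i < n" for i
    using that
  proof (induction i)
    case 0
    have "P 0 * P (n - 1) = \<beta> * (P (n - 1) * A n)"
      using sym[of 0] assms(1) by (simp add: P_def mult_ac)
    also have "P (n - 1) * A n = 1"
      using P_Suc[of "n - 1"] P_n assms(1) by simp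
    finally show ?case by simp
  next
    case (Suc i)
    have idx: "n - 1 - i = Suc (n - 1 - Suc i)" "n - Suc i = Suc (n - 1 - Suc i)"
      using Suc.prems by auto
    have "A (Suc i) = A (n - Suc i)" using sym[of "Suc i"] Suc.prems by simp
    then have "P (Suc i) * P (n - 1 - Suc i) = P i * P (n - 1 - i)"
      unfolding idx P_Suc by (simp add: mult_ac)
    then show ?case using Suc by simp
  qed
  have wr: "wronsk F k = [:P k:] * wronsk F (Suc k)" if "k < n" for k
    using wronsk_Suc[of n A F k] A(2) that by (simp add: P_def)
  have wr_nz: "wronsk F k \<noteq> 0" if "k \<le> n" for k
    using wronsk_chain[of n A F k] A(2) that by auto
  define u where "u i = coeff (theta_chain A (n - 1 - i))" for i
  define \<tau> where "\<tau> i = inverse (A i)" for i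
  have theta_top: "theta_comp (theta_chain A k) = Polynomial.smult (inverse (A (Suc k))) (theta_chain A (Suc k))"
    if "k < n" for k
    using fps_mult_inverse[OF A(1)[of "Suc k"]] that by simp
  interpret flag_basis n a u \<tau>
  proof
    show "u i r = 0" if "n - 1 - i < r" for i r
      using that by (simp add: u_def coeff_theta_chain_eq_0)
    show "fps_nth (u i (n - 1 - i)) 0 \<noteq> 0" if "i < n" for i
      using P_unit[of "n - 1 - i"] by (simp add: u_def lead_coeff_theta_chain P_def)
    show "fps_nth (\<tau> (Suc i)) 0 \<noteq> 0" if "Suc i < n" for i
      using A(1)[of "Suc i"] that by (simp add: \<tau>_def)
    have deg: "degree (theta_chain A k) < n" if "k < n" for k
      using degree_theta_chain[of A k] that by simp
    show "theta_lam n a (u 0) = (\<lambda>r. 0)"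
    proof -
      \<comment> \<open>Theta times the longest proper chain is a multiple of the operator itself,
        hence zero in the quotient module.\<close>
      have "theta_comp (theta_chain A (n - 1)) = Polynomial.smult (inverse (A n)) (L_op n a)"
        using theta_top[of "n - 1"] L assms(1) by simp
      moreover have "P (n - 1) = inverse (A n)"
      proof -
        have "P (n - 1) * A n = 1" using P_Suc[of "n - 1"] P_n assms(1) by simp
        then show ?thesis by (metis fps_inverse_unique mult.commute)
      qed
      then have "coeff (theta_chain A (n - 1)) (n - 1) = inverse (A n)"
        by (simp add: lead_coeff_theta_chain P_def)
      ultimately show ?thesis
        using deg[of "n - 1"] assms(1) by (simp add: u_def theta_lam_coeff fun_eq_iff)
    qed
    show "theta_lam n a (u (Suc i)) = (\<lambda>r. \<tau> (Suc i) * u i r)" if "Suc i < n" for i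
    proof -
      define k where "k = n - 1 - Suc i"
      have k: "Suc k = n - 1 - i" "n - Suc i = Suc k" "k < n - 1" using that by (auto simp: k_def)
      have "A (Suc i) = A (n - Suc i)" using sym[of "Suc i"] that by simp
      then have "A (Suc i) = A (Suc k)" by (simp only: k(2))
      \<comment> \<open>Theta does not raise the degree to \<open>n\<close> here, so no reduction
        modulo the operator takes place.\<close>
      moreover have "coeff (theta_chain A k) (n - 1) = 0"
        using k by (intro coeff_theta_chain_eq_0) simp
      ultimately show ?thesis
        using deg[of k] theta_top[of k] k(3)
        unfolding u_def k_def[symmetric] k(1)[symmetric] \<tau>_def
        by (simp add: theta_lam_coeff fun_eq_iff del: theta_chain.simps)
    qed
  qed
  have flag_eq: "flag (Suc i) = {(\<lambda>r. \<Sum>j\<le>i. c j * u j r) | c. True}" for i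
    by (auto simp: flag_def lincomb_def lessThan_Suc_atMost)
  have good: "good_sequence n F \<beta> (\<lambda>i. flag (Suc i)) u"
    unfolding good_sequence_def
  proof (intro allI impI conjI flag_eq)
    fix i assume i: "i < n"
    show "u i \<in> lam n" using i upper_zero by (auto simp: lam_def)
    show "u i r = 0" if "n - 1 - i < r" for r using upper_zero i that by blast
    have "[:u i (n - 1 - i):] * wronsk F i = [:P i * P (n - 1 - i):] * wronsk F (Suc i)"
      by (simp add: wr[OF i] u_def lead_coeff_theta_chain P_def mult_ac)
    then show "[:u i (n - 1 - i):] * wronsk F i = [:\<beta>:] * wronsk F (Suc i)"
      by (simp only: PP[OF i])
  qed
  have unique: "v i = u i" if "good_sequence n F \<beta> (\<lambda>i. flag (Suc i)) v" "i < n" for v i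
    using good_sequence_unique[OF wr_nz that(1) good that(2)] that(2) by simp
  have tau_wr: "[:\<tau> (Suc i):] * (wronsk F (Suc i))\<^sup>2 = wronsk F i * wronsk F (Suc (Suc i))"
    if "Suc i < n" for i
  proof -
    have inv: "inverse (A (Suc i)) * A (Suc i) = 1"
      using that by (intro fps_mult_inverse A(1)) simp
    have "[:\<tau> (Suc i):] * (wronsk F (Suc i))\<^sup>2 =
        [:inverse (A (Suc i)) * A (Suc i) * P i:] * (wronsk F (Suc (Suc i)) * wronsk F (Suc i))"
      unfolding power2_eq_square by (subst wr[OF that]) (simp add: P_Suc \<tau>_def mult_ac)
    also have "\<dots> = wronsk F i * wronsk F (Suc (Suc i))"
      unfolding inv using wr[of i] that by (simp add: mult_ac)
    finally show ?thesis .
  qed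
  have tau_1: "[:\<tau> 1:] * (F 0)\<^sup>2 = theta_log (F 1) * F 0 - F 1 * theta_log (F 0)" if "1 < n"
  proof -
    \<comment> \<open>As \<open>A 0\<close> is the inverse of \<open>F 0\<close>, this is
      \<open>F 1 / F 0 = log q\<close>; the next chain value turns its derivative into the inverse
      of \<open>A 1\<close>.\<close>
    define g where "g = [:A 0:] * F 1"
    have F0: "[:A 0:] * F 0 = 1" using A(2)[OF assms(1)] by simp
    have g: "[:A 1:] * theta_log g = 1" using A(2)[OF that] by (simp add: g_def)
    have "[:\<tau> 1:] * [:A 1:] = 1"
      using fps_mult_inverse[OF A(1)[of 1]] that by (simp add: \<tau>_def mult.commute)
    then have "theta_log g = [:\<tau> 1:] * ([:A 1:] * theta_log g)"
      by (simp only: mult.assoc[symmetric]) simp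
    then have "theta_log g = [:\<tau> 1:]" unfolding g by simp
    moreover have "F 1 = ([:A 0:] * F 0) * F 1" unfolding F0 by simp
    then have "F 1 = F 0 * g" unfolding g_def by (simp only: mult_ac)
    ultimately show ?thesis
      by (simp only: theta_log_mult power2_eq_square) (simp add: algebra_simps)
  qed
  show ?thesis
  proof (intro exI[of _ "\<lambda>i. flag (Suc i)"] conjI allI impI)
    show "admissible_filtration n a (\<lambda>i. flag (Suc i))" by (rule admissible_flag)
    show "U' i = flag (Suc i)" if "admissible_filtration n a U'" "i < n" for U' i
      using admissible_unique that .
    show "\<exists>u. good_sequence n F \<beta> (\<lambda>i. flag (Suc i)) u" using good by blast
    show "\<exists>c :: nat \<Rightarrow> 'a. \<forall>i<n. w i = (\<lambda>r. fps_const (c i) * v i r)"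
      if "good_sequence n F \<beta> (\<lambda>i. flag (Suc i)) v \<and> good_sequence n F \<beta> (\<lambda>i. flag (Suc i)) w" for v w
      \<comment> \<open>The leading coefficients are prescribed exactly, so both sequences equal
        \<open>u\<close> and all constants are 1.\<close>
      using that unique by (intro exI[of _ "\<lambda>_. 1"]) simp
    show "\<exists>\<tau>. (\<forall>i. Suc i < n \<longrightarrow>
                [:\<tau> (Suc i):] * (wronsk F (Suc i))\<^sup>2 = wronsk F i * wronsk F (Suc (Suc i)) \<and>
                theta_lam n a (v (Suc i)) = (\<lambda>r. \<tau> (Suc i) * v i r)) \<and>
             (1 < n \<longrightarrow> [:\<tau> 1:] * (F 0)\<^sup>2 = theta_log (F 1) * F 0 - F 1 * theta_log (F 0))"
      if "good_sequence n F \<beta> (\<lambda>i. flag (Suc i)) v" for v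
    proof (intro exI[of _ \<tau>] conjI allI impI)
      fix i assume i: "Suc i < n"
      show "[:\<tau> (Suc i):] * (wronsk F (Suc i))\<^sup>2 = wronsk F i * wronsk F (Suc (Suc i))"
        by (rule tau_wr[OF i])
      show "theta_lam n a (v (Suc i)) = (\<lambda>r. \<tau> (Suc i) * v i r)"
        using unique[OF that] theta_Suc i by simp
    next
      assume "1 < n"
      then show "[:\<tau> 1:] * (F 0)\<^sup>2 = theta_log (F 1) * F 0 - F 1 * theta_log (F 0)"
        by (rule tau_1)
    qed
  qed
qed

end
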